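(* Let $\mathcal{A}$ be a properly infinite von Neumann algebra acting on a Hilbert space $H$ and let $F\in\mathcal{A}$. Then $$\sigma_{eA}(F)=\bigcap\{\sigma_a(PF|_{\operatorname{Im}P}) : P\text{ is a finite projection in }\mathcal{A}\},$$ where $\sigma_a(PF|_{\operatorname{Im}P})=\{\lambda\in\mathbb{C}: (PF-\lambda I)|_{\operatorname{Im}P}\text{ is not bounded below on }\operatorname{Im}P\}$.
   Context: Projections are orthogonal projections, and $I$ is the identity operator on $H$. A projection of $\mathcal{A}$ is finite if it is not Murray–von Neumann equivalent in $\mathcal{A}$ to any of its proper subprojections. For closed subspaces $M,N$ of $H$, $H=M\tilde\oplus N$ means $M\cap N=\{0\}$ and $M+N=H$ (not necessarily orthogonal). $\widetilde{\mathcal{K}\Phi}_+^-(\mathcal{A})$ is the set of all $T\in\mathcal{A}$ for which there exist projections $P,Q,S\in\mathcal{A}$ such that $T$ maps $(I-P)(H)$ isomorphically onto $(I-Q)(H)$, $H=(I-Q)(H)\tilde\oplus S(H)$, $P(H)\subseteq S(H)$, and $P$ is finite. For $F\in\mathcal{A}$, $\sigma_{eA}(F)=\{\lambda\in\mathbb{C}: F-\lambda I\notin\widetilde{\mathcal{K}\Phi}_+^-(\mathcal{A})\}$.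
   Formalization: The intersection is taken over the projections P in A for which I − P is finite, instead of P finite; as written the claim fails, since P = 0 is finite and makes the intersection empty, while 0 lies in σ_eA(0) when H ≠ {0}. *)

theory Defs
  imports "HOL-Analysis.Analysis"
begin

text \<open>Complex Hilbert spaces as a type class. The inner product is linear in the first argument.
  The last axiom says at once that the inner product is positive definite and that the norm is the
  one it induces.\<close>

class complex_inner = real_normed_vector +
  fixes scaleC :: "complex \<Rightarrow> 'a \<Rightarrow> 'a" (infixr "*\<^sub>C" 75)
    and cinner :: "'a \<Rightarrow> 'a \<Rightarrow> complex"
  assumes scaleC_add_right: "c *\<^sub>C (x + y) = c *\<^sub>C x + c *\<^sub>C y"
    and scaleC_add_left: "(c + d) *\<^sub>C x = c *\<^sub>C x + d *\<^sub>C x"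
    and scaleC_scaleC: "c *\<^sub>C d *\<^sub>C x = (c * d) *\<^sub>C x"
    and scaleR_scaleC: "r *\<^sub>R x = complex_of_real r *\<^sub>C x"
    and cinner_commute: "cinner x y = cnj (cinner y x)"
    and cinner_add_left: "cinner (x + y) z = cinner x z + cinner y z"
    and cinner_scaleC_left: "cinner (c *\<^sub>C x) y = c * cinner x y"
    and cinner_self: "cinner x x = complex_of_real ((norm x)\<^sup>2)"

class complex_hilbert = complex_inner + complete_space

definition bounded_clinear :: "('a::complex_hilbert \<Rightarrow> 'a) \<Rightarrow> bool" where
  "bounded_clinear T \<longleftrightarrow> bounded_linear T \<and> (\<forall>c x. T (c *\<^sub>C x) = c *\<^sub>C T x)"

definition adjoint_pair :: "('a::complex_hilbert \<Rightarrow> 'a) \<Rightarrow> ('a \<Rightarrow> 'a) \<Rightarrow> bool" where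
  "adjoint_pair T S \<longleftrightarrow> (\<forall>x y. cinner (T x) y = cinner x (S y))"

definition commutant :: "('a::complex_hilbert \<Rightarrow> 'a) set \<Rightarrow> ('a \<Rightarrow> 'a) set" where
  "commutant A = {S. bounded_clinear S \<and> (\<forall>T\<in>A. S \<circ> T = T \<circ> S)}"

text \<open>Closure under sums, scalar multiples and products, as well as \<open>id \<in> A\<close>, need not be
  required separately: they hold for every commutant.\<close>

definition von_neumann_algebra :: "('a::complex_hilbert \<Rightarrow> 'a) set \<Rightarrow> bool" where
  "von_neumann_algebra A \<longleftrightarrow>
     (\<forall>T\<in>A. bounded_clinear T) \<and> (\<forall>T\<in>A. \<exists>S\<in>A. adjoint_pair T S) \<and>
     commutant (commutant A) = A"

definition projections :: "('a::complex_hilbert \<Rightarrow> 'a) set \<Rightarrow> ('a \<Rightarrow> 'a) set" where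
  "projections A = {P \<in> A. P \<circ> P = P \<and> adjoint_pair P P}"

definition mvn_equivalent ::
  "('a::complex_hilbert \<Rightarrow> 'a) set \<Rightarrow> ('a \<Rightarrow> 'a) \<Rightarrow> ('a \<Rightarrow> 'a) \<Rightarrow> bool" where
  "mvn_equivalent A P Q \<longleftrightarrow>
     (\<exists>V\<in>A. \<exists>W\<in>A. adjoint_pair V W \<and> W \<circ> V = P \<and> V \<circ> W = Q)"

definition finite_projection ::
  "('a::complex_hilbert \<Rightarrow> 'a) set \<Rightarrow> ('a \<Rightarrow> 'a) \<Rightarrow> bool" where
  "finite_projection A P \<longleftrightarrow> P \<in> projections A \<and>
     \<not> (\<exists>Q\<in>projections A. range Q \<subset> range P \<and> mvn_equivalent A P Q)"

definition properly_infinite :: "('a::complex_hilbert \<Rightarrow> 'a) set \<Rightarrow> bool" where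
  "properly_infinite A \<longleftrightarrow>
     (\<forall>Z\<in>projections A \<inter> commutant A. Z \<noteq> (\<lambda>x. 0) \<longrightarrow> \<not> finite_projection A Z)"

definition direct_decomposition :: "'a::complex_hilbert set \<Rightarrow> 'a set \<Rightarrow> bool" where
  "direct_decomposition M N \<longleftrightarrow> M \<inter> N = {0} \<and> {x + y | x y. x \<in> M \<and> y \<in> N} = UNIV"

text \<open>The range of \<open>\<lambda>x. x - P x\<close> is the image of \<open>I - P\<close>; since \<open>T\<close> is linear, the homeomorphism
  below is an isomorphism of the normed spaces \<open>(I - P)(H)\<close> and \<open>(I - Q)(H)\<close>.\<close>

definition KPhi :: "('a::complex_hilbert \<Rightarrow> 'a) set \<Rightarrow> ('a \<Rightarrow> 'a) set" where
  "KPhi A = {T \<in> A. \<exists>P\<in>projections A. \<exists>Q\<in>projections A. \<exists>S\<in>projections A.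
     (\<exists>T'. homeomorphism (range (\<lambda>x. x - P x)) (range (\<lambda>x. x - Q x)) T T') \<and>
     direct_decomposition (range (\<lambda>x. x - Q x)) (range S) \<and>
     range P \<subseteq> range S \<and> finite_projection A P}"

definition sigma_eA :: "('a::complex_hilbert \<Rightarrow> 'a) set \<Rightarrow> ('a \<Rightarrow> 'a) \<Rightarrow> complex set" where
  "sigma_eA A F = {l. (\<lambda>x. F x - l *\<^sub>C x) \<notin> KPhi A}"

definition bounded_below_on :: "('a::complex_hilbert \<Rightarrow> 'a) \<Rightarrow> 'a set \<Rightarrow> bool" where
  "bounded_below_on T M \<longleftrightarrow> (\<exists>c>0. \<forall>x\<in>M. c * norm x \<le> norm (T x))"

definition sigma_a_compression ::
  "('a::complex_hilbert \<Rightarrow> 'a) \<Rightarrow> ('a \<Rightarrow> 'a) \<Rightarrow> complex set" where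
  "sigma_a_compression P F = {l. \<not> bounded_below_on (\<lambda>x. P (F x) - l *\<^sub>C x) (range P)}"

text \<open>A description of \<open>sigma_eA A F\<close> as an intersection of the sets \<open>sigma_a_compression P F\<close> has to
  range over the projections \<open>P\<close> with \<open>I - P\<close> finite. Ranging over the finite \<open>P\<close> themselves
  fails already for \<open>F = 0\<close>: \<open>P = 0\<close> makes the intersection empty.\<close>

lemma sigma_eA_neq_Inter_finite_projections:
  fixes A :: "('a::complex_hilbert \<Rightarrow> 'a) set"
  assumes A: "von_neumann_algebra A" "properly_infinite A" and nontrivial: "\<exists>x::'a. x \<noteq> 0"
  shows "(\<lambda>x. 0) \<in> A"
    and "sigma_eA A (\<lambda>x. 0) \<noteq> \<Inter> {sigma_a_compression P (\<lambda>x. 0) | P. finite_projection A P}"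
proof -
  have sC0: "c *\<^sub>C (0::'a) = 0" for c
    using scaleC_add_right[of c "0::'a" 0] by simp
  have sCz: "0 *\<^sub>C x = (0::'a)" for x
    using scaleC_add_left[of 0 0 x] by simp
  have cl: "cinner (0::'a) y = 0" for y
    using cinner_add_left[of "0::'a" 0 y] by simp
  have cr: "cinner y (0::'a) = 0" for y
    using cinner_commute[of y 0] cl by simp
  have bicomm: "A = commutant (commutant A)"
    using A(1) by (simp add: von_neumann_algebra_def)
  have lin: "S 0 = 0" if "bounded_clinear S" for S :: "'a \<Rightarrow> 'a"
    using that by (simp add: bounded_clinear_def linear_simps)
  have zc: "(\<lambda>x. 0) \<in> commutant (commutant A)"
    by (auto simp: commutant_def bounded_clinear_def sC0 fun_eq_iff linear_simps)
  then show zA: "(\<lambda>x. 0) \<in> A"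
    using bicomm by blast
  have idc: "(\<lambda>x. x) \<in> commutant B" for B :: "('a \<Rightarrow> 'a) set"
    by (auto simp: commutant_def bounded_clinear_def)
  have idA: "(\<lambda>x. x) \<in> A"
    using bicomm idc by blast
  have fin0: "finite_projection A (\<lambda>x. 0)"
  proof -
    have "False" if "Q \<in> projections A" "range Q \<subset> range (\<lambda>x::'a. 0::'a)" for Q
    proof -
      have "range Q = range (\<lambda>x::'a. 0::'a)"
        using that(2) by fastforce
      with that(2) show False by simp
    qed
    moreover have "(\<lambda>x. 0) \<in> projections A"
      using zA by (simp add: projections_def adjoint_pair_def cl cr fun_eq_iff)
    ultimately show ?thesis
      unfolding finite_projection_def by blast
  qed
  have "sigma_a_compression (\<lambda>x. 0) (\<lambda>x. 0::'a) = {}"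
    by (simp add: sigma_a_compression_def bounded_below_on_def sC0 gt_ex)
  then have rhs: "\<Inter> {sigma_a_compression P (\<lambda>x. 0) | P. finite_projection A P} = {}"
    using fin0 Inter_lower[of "{}"] by (metis (mono_tags, lifting) mem_Collect_eq subset_empty)
  have "(\<lambda>x. 0) \<notin> KPhi A"
  proof
    assume "(\<lambda>x. 0) \<in> KPhi A"
    then obtain P Q T' :: "'a \<Rightarrow> 'a" where
      hom: "homeomorphism (range (\<lambda>x. x - P x)) (range (\<lambda>x. x - Q x)) (\<lambda>x::'a. 0) T'"
      and fin: "finite_projection A P"
      unfolding KPhi_def by blast
    have "bounded_clinear P"
      using fin A(1) by (auto simp: finite_projection_def projections_def von_neumann_algebra_def)
    then have "P 0 = 0" by (rule lin)
    have "x - P x = 0" for x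
    proof -
      have T': "T' 0 = y" if "y \<in> range (\<lambda>x. x - P x)" for y
        using hom that by (auto simp: homeomorphism_def)
      have "T' 0 = x - P x" "T' 0 = 0 - P 0"
        by (rule T', rule rangeI)+
      then show ?thesis
        using \<open>P 0 = 0\<close> by simp
    qed
    then have "P = (\<lambda>x. x)" by (simp add: fun_eq_iff)
    moreover have "(\<lambda>x::'a. x) \<noteq> (\<lambda>x. 0)"
      using nontrivial by (auto simp: fun_eq_iff)
    moreover have "(\<lambda>x. x) \<in> projections A \<inter> commutant A"
      using idA idc by (auto simp: projections_def adjoint_pair_def)
    ultimately show False
      using A(2) fin unfolding properly_infinite_def by metis
  qed
  then have "0 \<in> sigma_eA A (\<lambda>x. 0)"
    by (simp add: sigma_eA_def sCz)
  with rhs show "sigma_eA A (\<lambda>x. 0) \<noteq>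
      \<Inter> {sigma_a_compression P (\<lambda>x. 0) | P. finite_projection A P}"
    by (metis empty_iff)
qed

end

theory Submission
  imports Defs
begin

text \<open>Write \<open>T = F - \<lambda>I\<close>. On the range of a projection \<open>P\<close> the operator \<open>PF - \<lambda>I\<close> agrees
  with \<open>PT\<close>, so the theorem says that \<open>T\<close> belongs to the Fredholm class if and only if \<open>PT\<close> is
  bounded below on the range of some projection \<open>P\<close> of the algebra with \<open>I - P\<close> finite. The
  finite projection in the definition of the class and the one here are the same \<open>I - P\<close>; it is
  only carried along, and the content is the geometry of the subspace \<open>N = T(Im P)\<close>.

  Suppose \<open>T\<close> is an isomorphism from \<open>Im P\<close> onto \<open>N\<close> and \<open>N\<close> has a closed complement containing
  \<open>ker P\<close>. Closed complementary subspaces are at a positive angle, by the Baire category theorem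
  (\<open>complementary_subspaces_bound\<close>). Since \<open>Py\<close> differs from \<open>y\<close> by an element of \<open>ker P\<close>, which
  lies in the complement, \<open>P\<close> is bounded below on \<open>N\<close>, and hence \<open>PT\<close> is bounded below on \<open>Im P\<close>
  (\<open>KPhi_imp_compression_bounded_below\<close>).

  Conversely, let \<open>PT\<close> be bounded below on \<open>Im P\<close>. Then so is \<open>T\<close>, and both \<open>N = T(Im P)\<close> and
  \<open>PN\<close> are closed. As \<open>P\<close> is injective on \<open>N\<close>, the orthogonal complement of \<open>PN\<close> is a complement
  of \<open>N\<close>, and it contains \<open>ker P\<close> (\<open>compression_bounded_below_imp_KPhi\<close>). It remains to know that
  the orthogonal projections onto \<open>N\<close> and \<open>PN\<close> lie in the algebra. These are closed ranges of the
  elements \<open>TP\<close> and \<open>PTP\<close>, so this follows from the projection theorem and the bicommutant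
  property (\<open>closed_range_projection\<close>).\<close>

section \<open>Algebraically complementary closed subspaces\<close>

text \<open>The first half of the open mapping argument. The closures of the sets \<open>U n\<close> of sums \<open>m + k\<close>
  with \<open>norm m \<le> n\<close> cover the space, so one of them contains a ball by Baire's theorem. The
  difference of two points of that ball is approximated with a bounded \<open>M\<close>-part, and scaling
  makes the bound proportional to \<open>norm y\<close>.\<close>

lemma approximate_splitting:
  fixes M K :: "'a::banach set"
  assumes M: "subspace M" and K: "subspace K" and split: "\<And>y. \<exists>m\<in>M. \<exists>k\<in>K. y = m + k"
  obtains C where "C > 0"
    "\<And>y e. e > 0 \<Longrightarrow> \<exists>m\<in>M. \<exists>k\<in>K. norm m \<le> C * norm y \<and> norm (y - (m + k)) < e"
proof -
  define U where "U n = {m + k | m k. m \<in> M \<and> k \<in> K \<and> norm m \<le> real n}" for n :: nat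
  have "(\<Union>n. closure (U n)) = UNIV"
  proof -
    have "y \<in> (\<Union>n. closure (U n))" for y
    proof -
      obtain m k where mk: "m \<in> M" "k \<in> K" "y = m + k"
        using split by blast
      obtain n where "norm m \<le> real n"
        using real_arch_simple by blast
      with mk have "y \<in> U n"
        unfolding U_def by blast
      then show ?thesis
        using closure_subset by blast
    qed
    then show ?thesis by blast
  qed
  moreover have "Met_TC.mtopology interior_of \<Union> (range (\<lambda>n. closure (U n))) = {}"
    if "\<And>n. interior (closure (U n)) = {}"
    by (rule Met_TC.metric_Baire_category_alt) (use that in \<open>auto simp: complete_UNIV\<close>)
  ultimately obtain n where "interior (closure (U n)) \<noteq> {}"
    by fastforce
  then obtain z r where r: "r > 0" and zr: "ball z r \<subseteq> closure (U n)"
    by (metis ex_in_conv mem_interior)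
  have z: "z \<in> closure (U n)"
    using zr r by auto
  define C where "C = 4 * (real n + 1) / r"
  have C: "C > 0"
    using r by (simp add: C_def)
  have "\<exists>m\<in>M. \<exists>k\<in>K. norm m \<le> C * norm y \<and> norm (y - (m + k)) < e"
    if e: "e > 0" for y e
  proof (cases "y = 0")
    case True
    then show ?thesis
      using e subspace_0[OF M] subspace_0[OF K] by force
  next
    case False
    \<comment> \<open>This factor makes \<open>t *\<^sub>R y\<close> have norm \<open>r / 2\<close>, so that \<open>z + t *\<^sub>R y\<close> stays in the ball.\<close>
    define t where "t = r / (2 * norm y)"
    have t: "t > 0"
      using False r by (simp add: t_def)
    have "z + t *\<^sub>R y \<in> closure (U n)"
      using False r t zr by (auto simp: dist_norm t_def)
    then obtain u where u: "u \<in> U n" "dist u (z + t *\<^sub>R y) < t * e / 2"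
      using closure_approachable e t by (metis half_gt_zero mult_pos_pos)
    obtain v where v: "v \<in> U n" "dist v z < t * e / 2"
      using z closure_approachable e t by (metis half_gt_zero mult_pos_pos)
    obtain m1 k1 where u': "m1 \<in> M" "k1 \<in> K" "norm m1 \<le> real n" "u = m1 + k1"
      using u(1) unfolding U_def by blast
    obtain m2 k2 where v': "m2 \<in> M" "k2 \<in> K" "norm m2 \<le> real n" "v = m2 + k2"
      using v(1) unfolding U_def by blast
    define m where "m = (1/t) *\<^sub>R (m1 - m2)"
    define k where "k = (1/t) *\<^sub>R (k1 - k2)"
    have mM: "m \<in> M" and kK: "k \<in> K"
      using u' v' M K by (auto simp: m_def k_def subspace_diff subspace_scale)
    have "norm (m1 - m2) \<le> 2 * (real n + 1)"
      using u'(3) v'(3) norm_triangle_ineq4[of m1 m2] by simp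
    then have "norm m \<le> (1/t) * (2 * (real n + 1))"
      using t by (simp add: m_def divide_right_mono)
    also have "\<dots> = C * norm y"
      using r False by (simp add: t_def C_def field_simps)
    finally have nm: "norm m \<le> C * norm y" .
    have "t *\<^sub>R (y - (m + k)) = (z + t *\<^sub>R y - u) + (v - z)"
      using t by (simp add: m_def k_def u' v' algebra_simps)
    then have "t * norm (y - (m + k)) = norm ((z + t *\<^sub>R y - u) + (v - z))"
      using t by (metis abs_of_pos norm_scaleR)
    also have "\<dots> < t * e"
      using norm_triangle_ineq[of "z + t *\<^sub>R y - u" "v - z"] u(2) v(2)
      by (simp add: dist_norm norm_minus_commute)
    finally have "norm (y - (m + k)) < e"
      using t by simp
    then show ?thesis
      using nm mM kK by blast
  qed
  with C show thesis
    by (rule that)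
qed

text \<open>The projection onto \<open>M\<close> along \<open>K\<close> is bounded. An approximate splitting is turned into an
  exact one by splitting the remaining error again and again: each step halves the error, so the
  \<open>M\<close>-parts form a convergent series, and closedness keeps both limits in their subspaces. As
  \<open>M\<close> and \<open>K\<close> meet only in \<open>0\<close>, the exact splitting is the given one.\<close>

lemma complementary_subspaces_bound:
  fixes M K :: "'a::banach set"
  assumes M: "subspace M" "closed M" and K: "subspace K" "closed K"
    and split: "\<And>y. \<exists>m\<in>M. \<exists>k\<in>K. y = m + k" and disj: "M \<inter> K = {0}"
  obtains C where "C > 0" "\<And>m k. m \<in> M \<Longrightarrow> k \<in> K \<Longrightarrow> norm m \<le> C * norm (m + k)"
proof -
  obtain C where C: "C > 0" and approx:
    "\<And>y e. e > 0 \<Longrightarrow> \<exists>m\<in>M. \<exists>k\<in>K. norm m \<le> C * norm y \<and> norm (y - (m + k)) < e"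
    using approximate_splitting[OF M(1) K(1) split] by metis
  have "\<exists>m k. m \<in> M \<and> k \<in> K \<and> norm m \<le> C * norm y \<and> norm (y - (m + k)) \<le> norm y / 2" for y
  proof (cases "y = 0")
    case True
    then show ?thesis
      using subspace_0[OF M(1)] subspace_0[OF K(1)] by force
  next
    case False
    then show ?thesis
      using approx[of "norm y / 2" y] by fastforce
  qed
  then obtain f g where fg: "\<And>y. f y \<in> M" "\<And>y. g y \<in> K" "\<And>y. norm (f y) \<le> C * norm y"
    "\<And>y. norm (y - (f y + g y)) \<le> norm y / 2"
    by metis
  have bound: "norm m0 \<le> 2 * C * norm (m0 + k0)" if m0: "m0 \<in> M" and k0: "k0 \<in> K" for m0 k0
  proof -
    define y where "y = m0 + k0"
    \<comment> \<open>The error that is left after \<open>n\<close> approximate splittings.\<close>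
    define r where "r n = ((\<lambda>y. y - (f y + g y)) ^^ n) y" for n
    have r0: "r 0 = y" and rS: "\<And>n. r (Suc n) = r n - (f (r n) + g (r n))"
      by (auto simp: r_def)
    have rn: "norm (r n) \<le> norm y * (1/2) ^ n" for n
    proof (induction n)
      case (Suc n)
      then show ?case
        using fg(4)[of "r n"] by (simp add: rS)
    qed (simp add: r0)
    have fn: "norm (f (r n)) \<le> C * norm y * (1/2) ^ n" for n
      using order_trans[OF fg(3) mult_left_mono[OF rn[of n], of C]] C by (simp add: mult.assoc)
    have geo: "(\<lambda>n. C * norm y * (1/2) ^ n) sums (C * norm y * 2)"
      using sums_mult[OF geometric_sums[of "1/2::real"]] by simp
    have summ: "summable (\<lambda>n. f (r n))"
      by (rule summable_comparison_test'[OF sums_summable[OF geo] fn])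
    define m where "m = (\<Sum>n. f (r n))"
    have lim: "(\<lambda>n. \<Sum>i<n. f (r i)) \<longlonglongrightarrow> m"
      using summable_LIMSEQ[OF summ] by (simp add: m_def)
    have mM: "m \<in> M"
      by (rule closed_sequentially[OF M(2) _ lim]) (simp add: subspace_sum[OF M(1)] fg)
    have r_lim: "r \<longlonglongrightarrow> 0"
    proof (rule Lim_null_comparison[where g = "\<lambda>n. norm y * (1/2) ^ n"])
      show "(\<lambda>n. norm y * (1/2) ^ n) \<longlonglongrightarrow> 0"
        by (intro tendsto_mult_right_zero LIMSEQ_power_zero) simp
    qed (use rn in simp)
    have eq: "(\<Sum>i<n. g (r i)) = y - r n - (\<Sum>i<n. f (r i))" for n
      by (induction n) (auto simp: r0 rS algebra_simps)
    have "(\<lambda>n. \<Sum>i<n. g (r i)) \<longlonglongrightarrow> y - 0 - m"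
      unfolding eq by (intro tendsto_diff tendsto_const r_lim lim)
    then have kK: "y - 0 - m \<in> K"
      by (rule closed_sequentially[OF K(2), rotated]) (simp add: subspace_sum[OF K(1)] fg)
    have "m0 - m = (y - 0 - m) - k0"
      by (simp add: y_def)
    then have "m0 - m \<in> K"
      using subspace_diff[OF K(1) kK k0] by (simp only:)
    then have "m0 - m \<in> M \<inter> K"
      using subspace_diff[OF M(1) m0 mM] by blast
    then have "m0 = m"
      using disj by simp
    moreover have "norm m \<le> C * norm y * 2"
      unfolding m_def using norm_suminf_le[of "\<lambda>n. f (r n)", OF fn sums_summable[OF geo]]
        sums_unique[OF geo] by simp
    ultimately show ?thesis
      by (simp add: y_def mult_ac)
  qed
  show thesis
    using that[of "2 * C"] C bound by simp
qed

section \<open>Orthogonal projections in a complex Hilbert space\<close>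

instance complex_hilbert \<subseteq> banach ..

lemma cinner_add_right: "cinner (x::'a::complex_inner) (y + z) = cinner x y + cinner x z"
  by (metis cinner_add_left cinner_commute complex_cnj_add)

lemma cinner_scaleC_right: "cinner (x::'a::complex_inner) (c *\<^sub>C y) = cnj c * cinner x y"
  by (metis cinner_scaleC_left cinner_commute complex_cnj_mult)

lemma scaleC_minus1: "(- 1) *\<^sub>C (x::'a::complex_inner) = - x"
  using scaleR_scaleC[of "-1" x] by simp

lemma cinner_minus_left: "cinner (- x::'a::complex_inner) y = - cinner x y"
  by (metis cinner_scaleC_left mult_minus1 scaleC_minus1)

lemma cinner_minus_right: "cinner (x::'a::complex_inner) (- y) = - cinner x y"
  by (metis cinner_minus_left cinner_commute complex_cnj_minus)

lemma cinner_diff_left: "cinner (x - y::'a::complex_inner) z = cinner x z - cinner y z"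
  using cinner_add_left[of x "- y" z] by (simp add: cinner_minus_left)

lemma cinner_diff_right: "cinner (x::'a::complex_inner) (y - z) = cinner x y - cinner x z"
  using cinner_add_right[of x y "- z"] by (simp add: cinner_minus_right)

lemma cinner_zero_left: "cinner (0::'a::complex_inner) y = 0"
  using cinner_diff_left[of 0 0 y] by simp

lemma cinner_self_eq_0: "cinner (x::'a::complex_inner) x = 0 \<longleftrightarrow> x = 0"
  by (simp add: cinner_self)

lemma cinner_eq_0_commute: "cinner (x::'a::complex_inner) y = 0 \<longleftrightarrow> cinner y x = 0"
  by (metis cinner_commute complex_cnj_zero)

lemma norm_diff_sq:
  "(norm (x - y::'a::complex_inner))\<^sup>2 = (norm x)\<^sup>2 + (norm y)\<^sup>2 - 2 * Re (cinner x y)"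
proof -
  have "Re (cinner y x) = Re (cinner x y)"
    by (metis cinner_commute cnj.sel(1))
  then show ?thesis
    using arg_cong[OF cinner_self[of "x - y"], of Re]
    by (simp add: cinner_diff_left cinner_diff_right cinner_self[of x] cinner_self[of y]
        del: of_real_power)
qed

lemma norm_scaleC: "norm (c *\<^sub>C (x::'a::complex_inner)) = cmod c * norm x"
proof -
  have "complex_of_real ((norm (c *\<^sub>C x))\<^sup>2) = complex_of_real ((cmod c * norm x)\<^sup>2)"
    unfolding cinner_self[symmetric] cinner_scaleC_left cinner_scaleC_right
    using complex_norm_square[of c] by (simp add: cinner_self power_mult_distrib mult_ac)
  then have "(norm (c *\<^sub>C x))\<^sup>2 = (cmod c * norm x)\<^sup>2"
    using of_real_eq_iff by blast
  then show ?thesis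
    by (simp add: power2_eq_iff_nonneg)
qed

lemma parallelogram:
  "(norm (x - y::'a::complex_inner))\<^sup>2 + (norm (x + y))\<^sup>2 = 2 * (norm x)\<^sup>2 + 2 * (norm y)\<^sup>2"
  using norm_diff_sq[of x y] norm_diff_sq[of x "- y"] by (simp add: cinner_minus_right)

definition csubspace :: "'a::complex_inner set \<Rightarrow> bool" where
  "csubspace K \<longleftrightarrow> subspace K \<and> (\<forall>c. \<forall>x\<in>K. c *\<^sub>C x \<in> K)"

text \<open>By the parallelogram law, two points of \<open>K\<close> at almost minimal distance from \<open>x\<close> are close to
  each other, because their midpoint is in \<open>K\<close> too. So a minimising sequence converges.\<close>

lemma exists_nearest_point:
  fixes K :: "'a::complex_hilbert set"
  assumes K: "subspace K" "closed K"
  obtains k where "k \<in> K" "\<And>w. w \<in> K \<Longrightarrow> norm (x - k) \<le> norm (x - w)"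
proof -
  have ne: "K \<noteq> {}"
    using subspace_0[OF K(1)] by blast
  define d where "d = infdist x K"
  have d0: "d \<ge> 0"
    by (simp add: d_def infdist_nonneg)
  have dle: "d \<le> norm (x - w)" if "w \<in> K" for w
    using infdist_le[OF that, of x] by (simp add: d_def dist_norm)
  have "\<exists>w\<in>K. (norm (x - w))\<^sup>2 < d\<^sup>2 + 1 / real (Suc n)" for n
  proof -
    have "d < sqrt (d\<^sup>2 + 1 / real (Suc n))"
      by (rule real_less_rsqrt) simp
    then obtain w where "w \<in> K" and "dist x w < sqrt (d\<^sup>2 + 1 / real (Suc n))"
      using ne unfolding d_def infdist_def by (auto simp: cINF_less_iff)
    then have "(norm (x - w))\<^sup>2 < (sqrt (d\<^sup>2 + 1 / real (Suc n)))\<^sup>2"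
      unfolding dist_norm by (intro power_strict_mono) auto
    with \<open>w \<in> K\<close> show ?thesis
      by (auto simp: add_nonneg_nonneg)
  qed
  then obtain z where zK: "\<And>n. z n \<in> K"
    and zd: "\<And>n. (norm (x - z n))\<^sup>2 < d\<^sup>2 + 1 / real (Suc n)"
    by metis
  have close: "(norm (z m - z n))\<^sup>2 \<le> 2 / real (Suc m) + 2 / real (Suc n)" for m n
  proof -
    have mid: "(1/2) *\<^sub>R (z m + z n) \<in> K"
      using zK K(1) by (simp add: subspace_add subspace_scale)
    have "(x - z n) + (x - z m) = 2 *\<^sub>R (x - (1/2) *\<^sub>R (z m + z n))"
      by (simp add: algebra_simps scaleR_2)
    then have "norm ((x - z n) + (x - z m)) = 2 * norm (x - (1/2) *\<^sub>R (z m + z n))"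
      by simp
    then have "(2 * d)\<^sup>2 \<le> (norm ((x - z n) + (x - z m)))\<^sup>2"
      using dle[OF mid] d0 by (intro power_mono) auto
    moreover have "(x - z n) - (x - z m) = z m - z n"
      by simp
    ultimately show ?thesis
      using parallelogram[of "x - z n" "x - z m"] zd[of m] zd[of n]
      by (simp add: power_mult_distrib)
  qed
  have "Cauchy z"
  proof (rule metric_CauchyI)
    fix e :: real
    assume e: "e > 0"
    obtain N :: nat where N: "4 / e\<^sup>2 < real N"
      using reals_Archimedean2 by blast
    have "dist (z m) (z n) < e" if "m \<ge> N" "n \<ge> N" for m n
    proof -
      have "2 / real (Suc j) < e\<^sup>2 / 2" if "j \<ge> N" for j
      proof -
        have "4 / e\<^sup>2 < real (Suc j)"
          using N that by linarith
        then show ?thesis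
          using e by (simp add: field_simps)
      qed
      from this[OF that(1)] this[OF that(2)] have "(norm (z m - z n))\<^sup>2 < e\<^sup>2"
        using close[of m n] by linarith
      then show ?thesis
        using e power2_less_imp_less[of "norm (z m - z n)" e] by (simp add: dist_norm)
    qed
    then show "\<exists>N. \<forall>m\<ge>N. \<forall>n\<ge>N. dist (z m) (z n) < e"
      by blast
  qed
  then obtain k where k: "z \<longlonglongrightarrow> k"
    using Cauchy_convergent convergent_def by blast
  have kK: "k \<in> K"
    using closed_sequentially[OF K(2) _ k] zK by blast
  have "(norm (x - k))\<^sup>2 \<le> d\<^sup>2 + 0"
  proof (rule LIMSEQ_le)
    show "(\<lambda>n. (norm (x - z n))\<^sup>2) \<longlonglongrightarrow> (norm (x - k))\<^sup>2"
      by (intro tendsto_intros k)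
    show "(\<lambda>n. d\<^sup>2 + 1 / real (Suc n)) \<longlonglongrightarrow> d\<^sup>2 + 0"
      using LIMSEQ_inverse_real_of_nat
      by (intro tendsto_add tendsto_const) (simp add: inverse_eq_divide)
    show "\<exists>N. \<forall>n\<ge>N. (norm (x - z n))\<^sup>2 \<le> d\<^sup>2 + 1 / real (Suc n)"
      using less_imp_le[OF zd] by simp
  qed
  then have "norm (x - k) \<le> d"
    using d0 power2_le_imp_le[of "norm (x - k)" d] by simp
  then show thesis
    by (intro that[OF kK]) (rule order_trans[OF _ dle])
qed

text \<open>The nearest point \<open>k\<close> is the foot of the perpendicular: if \<open>x - k\<close> had a nonzero inner product
  with some \<open>z \<in> K\<close>, then a small step from \<open>k\<close> along a suitable multiple of \<open>z\<close> would come closer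
  to \<open>x\<close>.\<close>

lemma exists_orthogonal_foot:
  fixes K :: "'a::complex_hilbert set"
  assumes K: "csubspace K" "closed K"
  obtains k where "k \<in> K" "\<And>z. z \<in> K \<Longrightarrow> cinner (x - k) z = 0"
proof -
  obtain k where kK: "k \<in> K" and near: "\<And>w. w \<in> K \<Longrightarrow> norm (x - k) \<le> norm (x - w)"
    using exists_nearest_point K unfolding csubspace_def by metis
  have "cinner (x - k) z = 0" if z: "z \<in> K" for z
  proof -
    define a where "a = cinner (x - k) z"
    \<comment> \<open>The step length is chosen with \<open>t * (norm z)\<^sup>2 \<le> 1\<close>, so that the second-order cost of the
      step is at most half of its first-order gain; the added 1 covers \<open>z = 0\<close>.\<close>
    define t where "t = 1 / ((norm z)\<^sup>2 + 1)"
    have pos: "(norm z)\<^sup>2 + 1 > 0"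
      by (simp add: add_nonneg_pos)
    define w where "w = (complex_of_real t * a) *\<^sub>C z"
    have "k + w \<in> K"
      using K(1) kK z by (simp add: csubspace_def w_def subspace_add)
    then have "norm (x - k) \<le> norm ((x - k) - w)"
      using near[of "k + w"] by (simp add: diff_diff_eq)
    then have "(norm (x - k))\<^sup>2 \<le> (norm ((x - k) - w))\<^sup>2"
      by (simp add: power_mono)
    then have "2 * Re (cinner (x - k) w) \<le> (norm w)\<^sup>2"
      by (simp add: norm_diff_sq)
    moreover have "cinner (x - k) w = complex_of_real (t * (cmod a)\<^sup>2)"
      using complex_norm_square[of a]
      by (simp add: w_def cinner_scaleC_right a_def[symmetric] mult_ac)
    moreover have "(norm w)\<^sup>2 = t\<^sup>2 * (cmod a)\<^sup>2 * (norm z)\<^sup>2"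
      by (simp add: w_def norm_scaleC norm_mult power_mult_distrib)
    ultimately have "2 * (t * (cmod a)\<^sup>2) \<le> t * (cmod a)\<^sup>2 * (t * (norm z)\<^sup>2)"
      by (simp add: power2_eq_square mult_ac)
    moreover have "t * (cmod a)\<^sup>2 * (t * (norm z)\<^sup>2) \<le> t * (cmod a)\<^sup>2 * 1"
      using pos by (intro mult_left_mono) (auto simp: t_def)
    ultimately have "t * (cmod a)\<^sup>2 \<le> 0"
      by linarith
    then have "a = 0"
      using pos by (simp add: t_def zero_less_mult_iff mult_le_0_iff divide_le_0_iff)
    then show ?thesis
      by (simp add: a_def)
  qed
  with kK show thesis
    by (rule that)
qed

lemma bounded_clinearD:
  assumes "bounded_clinear T"
  shows "bounded_linear T" "T (c *\<^sub>C x) = c *\<^sub>C T x" "T (x + y) = T x + T y" "T (x - y) = T x - T y"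
    "T 0 = 0"
  using assms by (auto simp: bounded_clinear_def linear_simps)

text \<open>The last property characterises \<open>R x\<close> by orthogonality. It is what identifies \<open>R (S x)\<close> with
  \<open>S (R x)\<close> when \<open>S\<close> preserves both \<open>K\<close> and its orthogonal complement.\<close>

lemma exists_orthogonal_projection:
  fixes K :: "'a::complex_hilbert set"
  assumes K: "csubspace K" "closed K"
  obtains R where "bounded_clinear R" "R \<circ> R = R" "adjoint_pair R R" "range R = K"
    "\<And>x y. y \<in> K \<Longrightarrow> (\<And>z. z \<in> K \<Longrightarrow> cinner (x - y) z = 0) \<Longrightarrow> R x = y"
proof -
  have "\<exists>k\<in>K. \<forall>z\<in>K. cinner (x - k) z = 0" for x
    by (rule exists_orthogonal_foot[OF K, of x]) blast
  then obtain R where RK: "\<And>x. R x \<in> K" and orth: "\<And>x z. z \<in> K \<Longrightarrow> cinner (x - R x) z = 0"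
    by metis
  have sub: "subspace K"
    using K(1) by (simp add: csubspace_def)
  have unique: "R x = y" if y: "y \<in> K" and yo: "\<And>z. z \<in> K \<Longrightarrow> cinner (x - y) z = 0" for x y
  proof -
    have in_K: "R x - y \<in> K"
      using RK y sub by (simp add: subspace_diff)
    have "cinner ((x - y) - (x - R x)) (R x - y) = 0"
      unfolding cinner_diff_left[of "x - y" "x - R x"] using orth[OF in_K] yo[OF in_K] by simp
    then have "cinner (R x - y) (R x - y) = 0"
      by simp
    then show ?thesis
      by (simp add: cinner_self_eq_0)
  qed
  have add: "R (x + y) = R x + R y" for x y
  proof (rule unique)
    show "R x + R y \<in> K"
      using RK sub by (simp add: subspace_add)
    fix z assume z: "z \<in> K"
    have "x + y - (R x + R y) = (x - R x) + (y - R y)"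
      by simp
    then show "cinner (x + y - (R x + R y)) z = 0"
      by (simp only: cinner_add_left orth[OF z]) simp
  qed
  have scale: "R (c *\<^sub>C x) = c *\<^sub>C R x" for c x
  proof (rule unique)
    show "c *\<^sub>C R x \<in> K"
      using RK K(1) by (simp add: csubspace_def)
    fix z assume z: "z \<in> K"
    show "cinner (c *\<^sub>C x - c *\<^sub>C R x) z = 0"
      using orth[OF z, of x] by (simp add: cinner_diff_left cinner_scaleC_left)
  qed
  have norm_R: "norm (R x) \<le> norm x" for x
  proof -
    have "(norm (x - R x))\<^sup>2 = (norm x)\<^sup>2 - (norm (R x))\<^sup>2"
      using norm_diff_sq[of x "R x"] orth[OF RK, of x x] by (simp add: cinner_diff_left cinner_self)
    then have "(norm (R x))\<^sup>2 \<le> (norm x)\<^sup>2"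
      using zero_le_power2[of "norm (x - R x)"] by linarith
    then show ?thesis
      by (rule power2_le_imp_le) simp
  qed
  have "bounded_linear R"
    by (rule bounded_linear_intro[of _ 1]) (auto simp: add scale scaleR_scaleC norm_R)
  then have bcl: "bounded_clinear R"
    by (simp add: bounded_clinear_def scale)
  have fixed: "R x = x" if "x \<in> K" for x
    using that by (intro unique) (simp_all add: cinner_zero_left)
  have "cinner (R x) y = cinner x (R y)" for x y
  proof -
    have "cinner (R x) (y - R y) = 0"
      using orth[OF RK] cinner_eq_0_commute by blast
    then show ?thesis
      using orth[OF RK, of x y] by (simp add: cinner_diff_left cinner_diff_right)
  qed
  then have "adjoint_pair R R"
    by (simp add: adjoint_pair_def)
  moreover have "R \<circ> R = R"
    by (simp add: fun_eq_iff fixed RK)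
  moreover have "range R = K"
  proof
    show "range R \<subseteq> K"
      using RK by blast
    show "K \<subseteq> range R"
      by (rule subsetI, rule range_eqI, rule fixed[symmetric])
  qed
  ultimately show thesis
    by (intro that[OF bcl _ _ _ unique])
qed

section \<open>Projections of a von Neumann algebra\<close>

lemma commutant_diff:
  assumes "\<And>T. T \<in> B \<Longrightarrow> bounded_clinear T" "U \<in> commutant B" "V \<in> commutant B"
  shows "(\<lambda>x. U x - V x) \<in> commutant B"
proof -
  have "c *\<^sub>C (x - y) = c *\<^sub>C x - c *\<^sub>C y" for c and x y :: 'a
    by (metis add_diff_cancel diff_add_cancel scaleC_add_right)
  then show ?thesis
    using assms by (auto simp: commutant_def bounded_clinear_def bounded_linear_sub fun_eq_iff linear_simps)
qed

lemma commutant_comp: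
  assumes "U \<in> commutant B" "V \<in> commutant B"
  shows "U \<circ> V \<in> commutant B"
  using assms bounded_linear_compose[of U V]
  by (auto simp: commutant_def bounded_clinear_def fun_eq_iff o_def)

lemma scaleC_in_commutant:
  assumes "\<And>T. T \<in> B \<Longrightarrow> bounded_clinear T"
  shows "(\<lambda>x. c *\<^sub>C x) \<in> commutant B"
proof -
  have "bounded_linear (\<lambda>x::'a. c *\<^sub>C x)"
    by (rule bounded_linear_intro[of _ "cmod c"])
      (auto simp: scaleC_add_right scaleR_scaleC scaleC_scaleC norm_scaleC mult_ac)
  then show ?thesis
    using assms by (auto simp: commutant_def bounded_clinear_def scaleC_scaleC mult_ac fun_eq_iff)
qed

text \<open>A von Neumann algebra is a commutant, namely of its own commutant, and thus inherits the closure
  properties of commutants.\<close>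

lemma von_neumann_algebra_closed:
  assumes A: "von_neumann_algebra A"
  shows "U \<in> A \<Longrightarrow> bounded_clinear U"
    and "U \<in> A \<Longrightarrow> V \<in> A \<Longrightarrow> (\<lambda>x. U x - V x) \<in> A"
    and "U \<in> A \<Longrightarrow> V \<in> A \<Longrightarrow> U \<circ> V \<in> A"
    and "(\<lambda>x. c *\<^sub>C x) \<in> A"
    and "(\<lambda>x. x) \<in> A"
proof -
  have eq: "A = commutant (commutant A)"
    using A by (simp add: von_neumann_algebra_def)
  have bcl: "bounded_clinear T" if "T \<in> commutant A" for T
    using that by (simp add: commutant_def)
  show "U \<in> A \<Longrightarrow> bounded_clinear U"
    using A by (simp add: von_neumann_algebra_def)
  show "U \<in> A \<Longrightarrow> V \<in> A \<Longrightarrow> (\<lambda>x. U x - V x) \<in> A"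
    by (subst eq, rule commutant_diff[OF bcl]) (use eq in auto)
  show "U \<in> A \<Longrightarrow> V \<in> A \<Longrightarrow> U \<circ> V \<in> A"
    by (subst eq, rule commutant_comp) (use eq in auto)
  show "(\<lambda>x. c *\<^sub>C x) \<in> A"
    using scaleC_in_commutant[OF bcl] eq by blast
  have "(\<lambda>x. x) \<in> commutant (commutant A)"
    by (auto simp: commutant_def bounded_clinear_def)
  then show "(\<lambda>x. x) \<in> A"
    using eq by simp
qed

lemma projections_complement:
  assumes A: "von_neumann_algebra A" and P: "P \<in> projections A"
  shows "(\<lambda>x. x - P x) \<in> projections A"
proof -
  have PA: "P \<in> A" and idem: "P (P x) = P x" and adj: "cinner (P x) y = cinner x (P y)" for x y
    using P by (auto simp: projections_def adjoint_pair_def fun_eq_iff)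
  note PD = bounded_clinearD[OF von_neumann_algebra_closed(1)[OF A PA]]
  have "(\<lambda>x. x - P x) \<in> A"
    using von_neumann_algebra_closed(2,5)[OF A] PA by blast
  then show ?thesis
    by (auto simp: projections_def adjoint_pair_def fun_eq_iff PD idem adj
        cinner_diff_left cinner_diff_right)
qed

lemma projection_range:
  assumes A: "von_neumann_algebra A" and P: "P \<in> projections A"
  shows "y \<in> range P \<longleftrightarrow> P y = y" and "y \<in> range (\<lambda>x. x - P x) \<longleftrightarrow> P y = 0"
    and "subspace (range P)" and "closed (range P)"
proof -
  have PA: "P \<in> A" and idem: "P (P x) = P x" for x
    using P by (auto simp: projections_def fun_eq_iff)
  note PD = bounded_clinearD[OF von_neumann_algebra_closed(1)[OF A PA]]
  show *: "y \<in> range P \<longleftrightarrow> P y = y" for y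
    by (metis idem rangeE rangeI)
  show "y \<in> range (\<lambda>x. x - P x) \<longleftrightarrow> P y = 0"
  proof
    assume "P y = 0"
    then have "y = y - P y" by simp
    then show "y \<in> range (\<lambda>x. x - P x)" by (rule range_eqI)
  qed (auto simp: PD idem)
  show "subspace (range P)"
    using linear_subspace_image[OF _ subspace_UNIV] bounded_linear.linear[OF PD(1)] by blast
  have "range P = {y. P y = y}"
    using * by blast
  then show "closed (range P)"
    using closed_Collect_eq[OF linear_continuous_on[OF PD(1)] continuous_on_id] by simp
qed

text \<open>An operator \<open>S\<close> of the commutant preserves the range of \<open>B\<close>, since it commutes with \<open>B\<close>, and
  the orthogonal complement of that range, which is the kernel of the adjoint of \<open>B\<close>, since the
  adjoint is in the algebra as well. So \<open>S\<close> commutes with the projection \<open>R\<close>, and \<open>R\<close> is in the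
  bicommutant.\<close>

lemma closed_range_projection:
  fixes A :: "('a::complex_hilbert \<Rightarrow> 'a) set"
  assumes A: "von_neumann_algebra A" and B: "B \<in> A" and cl: "closed (range B)"
  obtains R where "R \<in> projections A" "range R = range B"
proof -
  note BD = bounded_clinearD[OF von_neumann_algebra_closed(1)[OF A B]]
  have "subspace (range B)"
    using linear_subspace_image[OF _ subspace_UNIV] bounded_linear.linear[OF BD(1)] by blast
  moreover have "c *\<^sub>C B x \<in> range B" for c x
    by (simp flip: BD(2))
  ultimately have "csubspace (range B)"
    by (auto simp: csubspace_def)
  then obtain R where R: "bounded_clinear R" "R \<circ> R = R" "adjoint_pair R R" "range R = range B"
    and unique: "\<And>x y. y \<in> range B \<Longrightarrow> (\<And>z. z \<in> range B \<Longrightarrow> cinner (x - y) z = 0) \<Longrightarrow> R x = y"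
    using exists_orthogonal_projection[OF _ cl] by metis
  obtain C where CA: "C \<in> A" and C: "\<And>x y. cinner (B x) y = cinner x (C y)"
    using A B by (auto simp: von_neumann_algebra_def adjoint_pair_def)
  have orth: "(\<forall>z\<in>range B. cinner u z = 0) \<longleftrightarrow> C u = 0" for u
  proof -
    have "(\<forall>z\<in>range B. cinner u z = 0) \<longleftrightarrow> (\<forall>x. cinner (C u) x = 0)"
      using C cinner_eq_0_commute by (metis (no_types, lifting) rangeE rangeI)
    also have "\<dots> \<longleftrightarrow> C u = 0"
      using cinner_self_eq_0 cinner_zero_left by metis
    finally show ?thesis .
  qed
  have CR: "C (x - R x) = 0" for x
  proof -
    have "cinner (x - R x) z = 0" if "z \<in> range B" for z
    proof -
      have "R z = z"
        using that R(2,4) by (metis comp_apply imageE)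
      then have "cinner (R x) z = cinner x z"
        using R(3) by (simp add: adjoint_pair_def)
      then show ?thesis
        by (simp add: cinner_diff_left)
    qed
    then show ?thesis
      using orth by blast
  qed
  have "R \<circ> S = S \<circ> R" if S: "S \<in> commutant A" for S
  proof
    fix x
    have bclS: "bounded_clinear S" and SB: "\<And>x. S (B x) = B (S x)" and SC: "\<And>x. S (C x) = C (S x)"
      using S B CA by (auto simp: commutant_def fun_eq_iff)
    note SD = bounded_clinearD[OF bclS]
    have "S (R x) \<in> range B"
      using R(4) SB by (metis rangeE rangeI)
    moreover have "C (S x - S (R x)) = 0"
      using CR[of x] SC[of "x - R x"] by (simp add: SD)
    then have "\<And>z. z \<in> range B \<Longrightarrow> cinner (S x - S (R x)) z = 0"
      using orth by blast
    ultimately have "R (S x) = S (R x)"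
      by (rule unique)
    then show "(R \<circ> S) x = (S \<circ> R) x"
      by simp
  qed
  then have "R \<in> commutant (commutant A)"
    using R(1) by (simp add: commutant_def[of "commutant A"])
  then have "R \<in> projections A"
    using A R by (simp add: von_neumann_algebra_def projections_def)
  then show thesis
    using R(4) by (rule that)
qed

section \<open>Fredholm operators and compressions\<close>

text \<open>The next two lemmas translate between isomorphisms in the topological sense, as they occur in
  the Fredholm class, and lower bounds.\<close>

lemma bounded_below_homeomorphism:
  fixes T :: "'a::real_normed_vector \<Rightarrow> 'b::real_normed_vector"
  assumes T: "bounded_linear T" and M: "subspace M" and bb: "\<exists>c>0. \<forall>x\<in>M. c * norm x \<le> norm (T x)"
  shows "\<exists>T'. homeomorphism M (T ` M) T T'"
proof -
  obtain c where c: "c > 0" and cT: "\<And>x. x \<in> M \<Longrightarrow> c * norm x \<le> norm (T x)"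
    using bb by blast
  have dist: "c * dist x y \<le> dist (T x) (T y)" if "x \<in> M" "y \<in> M" for x y
    using cT[OF subspace_diff[OF M that]] T by (simp add: dist_norm linear_simps)
  have inj: "inj_on T M"
  proof (rule inj_onI)
    fix x y assume "x \<in> M" "y \<in> M" "T x = T y"
    then have "c * dist x y \<le> 0"
      using dist[of x y] by simp
    then show "x = y"
      using c by (simp add: mult_le_0_iff)
  qed
  have "continuous_on (T ` M) (inv_into M T)"
    unfolding continuous_on_iff
  proof (intro ballI allI impI)
    fix u e assume u: "u \<in> T ` M" and e: "(0::real) < e"
    have "dist (inv_into M T v) (inv_into M T u) < e" if "v \<in> T ` M" "dist v u < c * e" for v
    proof -
      have "c * dist (inv_into M T v) (inv_into M T u) \<le> dist v u"
        using dist[OF inv_into_into inv_into_into] u that(1) by (metis f_inv_into_f)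
      then have "c * dist (inv_into M T v) (inv_into M T u) < c * e"
        using that(2) by linarith
      then show ?thesis
        using c by simp
    qed
    then show "\<exists>d>0. \<forall>v\<in>T ` M. dist v u < d \<longrightarrow> dist (inv_into M T v) (inv_into M T u) < e"
      using c e by (intro exI[of _ "c * e"]) auto
  qed
  then have "homeomorphism M (T ` M) T (inv_into M T)"
    using inj linear_continuous_on[OF T] by (auto simp: homeomorphism_def inv_into_into f_inv_into_f)
  then show ?thesis by blast
qed

lemma homeomorphism_bounded_below:
  fixes T :: "'a::real_normed_vector \<Rightarrow> 'b::real_normed_vector"
  assumes T: "linear T" and M: "subspace M" and hom: "homeomorphism M N T T'"
  shows "\<exists>c>0. \<forall>x\<in>M. c * norm x \<le> norm (T x)"
proof -
  have T0: "T 0 = 0" and 0: "0 \<in> M"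
    using T M by (auto simp: linear_0 subspace_0)
  have TN: "T x \<in> N" and TT: "T' (T x) = x" if "x \<in> M" for x
    using hom that by (auto simp: homeomorphism_def)
  have "continuous_on N T'"
    using hom by (simp add: homeomorphism_def)
  moreover have "0 \<in> N" "T' 0 = 0"
    using TN[OF 0] TT[OF 0] T0 by auto
  ultimately obtain d where d: "d > 0" and dN: "\<And>y. y \<in> N \<Longrightarrow> norm y < d \<Longrightarrow> norm (T' y) < 1"
    unfolding continuous_on_iff by (metis dist_0_norm dist_commute zero_less_one)
  have "d / 2 * norm x \<le> norm (T x)" if x: "x \<in> M" for x
  proof (rule ccontr)
    assume "\<not> ?thesis"
    then have less: "norm (T x) < d / 2 * norm x"
      by simp
    then have pos: "norm x > 0"
      using norm_ge_zero[of "T x"] by (cases "x = 0") auto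
    define y where "y = (1 / norm x) *\<^sub>R x"
    have y: "y \<in> M" "norm y = 1"
      using x M pos by (auto simp: y_def subspace_scale)
    have "norm (T y) < d / 2"
      using less pos by (simp add: y_def linear_scale[OF T] field_simps)
    then have "norm (T y) < d"
      using d by linarith
    then show False
      using dN[OF TN[OF y(1)]] TT[OF y(1)] y(2) by simp
  qed
  then show ?thesis
    using d half_gt_zero by blast
qed

text \<open>The projection \<open>P\<close> is the complement of the finite projection \<open>P0\<close> that witnesses the
  membership. For \<open>x\<close> in its range, \<open>P (T x)\<close> is the sum of \<open>T x\<close>, which lies in the first summand
  \<open>N\<close> of the decomposition, and \<open>- P0 (T x)\<close>, which lies in the second one. The positive angle
  between the summands bounds \<open>T x\<close>, and hence \<open>x\<close>, by \<open>P (T x)\<close>.\<close>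

lemma KPhi_imp_compression_bounded_below:
  assumes A: "von_neumann_algebra A" and T: "T \<in> KPhi A"
  shows "\<exists>P\<in>projections A. finite_projection A (\<lambda>x. x - P x) \<and>
    bounded_below_on (\<lambda>x. P (T x)) (range P)"
proof -
  obtain P0 Q S T' where P0: "P0 \<in> projections A" and Q: "Q \<in> projections A" and S: "S \<in> projections A"
    and hom: "homeomorphism (range (\<lambda>x. x - P0 x)) (range (\<lambda>x. x - Q x)) T T'"
    and dd: "direct_decomposition (range (\<lambda>x. x - Q x)) (range S)"
    and sub: "range P0 \<subseteq> range S" and fin: "finite_projection A P0"
    using T unfolding KPhi_def by blast
  have TA: "T \<in> A"
    using T by (simp add: KPhi_def)
  note TD = bounded_clinearD[OF von_neumann_algebra_closed(1)[OF A TA]]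
  define P where "P = (\<lambda>x. x - P0 x)"
  define N where "N = range (\<lambda>x. x - Q x)"
  have P: "P \<in> projections A" and Q': "(\<lambda>x. x - Q x) \<in> projections A"
    using projections_complement[OF A] P0 Q by (auto simp: P_def)
  note RP = projection_range[OF A P] and RQ = projection_range[OF A Q', folded N_def]
    and RS = projection_range[OF A S]
  obtain c where c: "c > 0" and cT: "\<And>x. x \<in> range P \<Longrightarrow> c * norm x \<le> norm (T x)"
    using homeomorphism_bounded_below[OF bounded_linear.linear[OF TD(1)] RP(3) hom[folded P_def]]
    by metis
  have split: "\<exists>m\<in>N. \<exists>k\<in>range S. y = m + k" for y
    using dd unfolding direct_decomposition_def N_def by blast
  have disj: "N \<inter> range S = {0}"
    using dd unfolding direct_decomposition_def N_def by blast
  obtain C where C: "C > 0" and CN: "\<And>m k. m \<in> N \<Longrightarrow> k \<in> range S \<Longrightarrow> norm m \<le> C * norm (m + k)"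
    using complementary_subspaces_bound[OF RQ(3,4) RS(3,4) split disj] by metis
  have "c / C * norm x \<le> norm (P (T x))" if x: "x \<in> range P" for x
  proof -
    have "T x \<in> N"
      using hom x unfolding homeomorphism_def P_def N_def by blast
    moreover have "- P0 (T x) \<in> range S"
      using sub RS(3) subspace_neg by blast
    ultimately have "norm (T x) \<le> C * norm (P (T x))"
      using CN[of "T x" "- P0 (T x)"] by (simp add: P_def)
    with cT[OF x] have "c * norm x \<le> C * norm (P (T x))"
      by linarith
    then show ?thesis
      using C by (simp add: field_simps)
  qed
  then have "bounded_below_on (\<lambda>x. P (T x)) (range P)"
    using c C unfolding bounded_below_on_def by (intro exI[of _ "c / C"]) auto
  moreover have "(\<lambda>x. x - P x) = P0"
    by (simp add: P_def)
  ultimately show ?thesis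
    using P fin by metis
qed

lemma direct_decompositionI:
  assumes "\<And>y. y \<in> M \<Longrightarrow> y \<in> N \<Longrightarrow> y = 0" "0 \<in> M" "0 \<in> N"
    and "\<And>y. \<exists>m\<in>M. \<exists>k\<in>N. y = m + k"
  shows "direct_decomposition M N"
  using assms unfolding direct_decomposition_def by blast

text \<open>Let \<open>R1\<close> and \<open>R2\<close> be the projections onto \<open>T(Im P)\<close> and \<open>PT(Im P)\<close>. The witnesses are \<open>I - P\<close>,
  \<open>Q = I - R1\<close> and \<open>S = I - R2\<close>. As \<open>R2\<close> is a subprojection of \<open>P\<close>, the kernel of \<open>P\<close> is contained
  in the range of \<open>S\<close>, and \<open>R2\<close> agrees with \<open>P\<close> on \<open>T(Im P)\<close>. Hence \<open>R2\<close> maps \<open>T(Im P)\<close>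
  bijectively onto its own range, which says that \<open>T(Im P)\<close> and \<open>ker R2 = Im S\<close> are complementary.\<close>

lemma compression_bounded_below_imp_KPhi:
  assumes A: "von_neumann_algebra A" and TA: "T \<in> A" and P: "P \<in> projections A"
    and fin: "finite_projection A (\<lambda>x. x - P x)"
    and bb: "bounded_below_on (\<lambda>x. P (T x)) (range P)"
  shows "T \<in> KPhi A"
proof -
  have PA: "P \<in> A" and idem: "\<And>x. P (P x) = P x"
    using P by (auto simp: projections_def fun_eq_iff)
  note vN = von_neumann_algebra_closed[OF A]
  note PD = bounded_clinearD[OF vN(1)[OF PA]] and TD = bounded_clinearD[OF vN(1)[OF TA]]
  note RP = projection_range[OF A P]
  have P': "(\<lambda>x. x - P x) \<in> projections A"
    by (rule projections_complement[OF A P])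
  have complete: "complete (range P)"
    using RP(4) by (simp add: complete_eq_closed)
  have bbPT: "\<exists>c>0. \<forall>x\<in>range P. c * norm x \<le> norm (P (T x))"
    using bb by (simp add: bounded_below_on_def)
  then obtain c where c: "c > 0" and cPT: "\<And>x. x \<in> range P \<Longrightarrow> c * norm x \<le> norm (P (T x))"
    by blast
  obtain K where K: "K > 0" "\<And>x. norm (P x) \<le> norm x * K"
    using bounded_linear.pos_bounded[OF PD(1)] by blast
  have cT: "c / K * norm x \<le> norm (T x)" if "x \<in> range P" for x
    using cPT[OF that] K(2)[of "T x"] K(1) by (simp add: field_simps)
  then have bbT: "\<exists>c>0. \<forall>x\<in>range P. c * norm x \<le> norm (T x)"
    using c K(1) divide_pos_pos by blast
  have TP: "T \<circ> P \<in> A" and PTP: "P \<circ> (T \<circ> P) \<in> A"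
    using vN(3) TA PA by auto
  have "complete (T ` range P)"
    using complete_isometric_image[OF _ RP(3) TD(1) _ complete] bbT by metis
  then have "closed (range (T \<circ> P))"
    by (simp add: complete_imp_closed image_comp)
  then obtain R1 where R1: "R1 \<in> projections A" "range R1 = range (T \<circ> P)"
    using closed_range_projection[OF A TP] by metis
  have "complete ((\<lambda>x. P (T x)) ` range P)"
    using complete_isometric_image[OF _ RP(3) bounded_linear_compose[OF PD(1) TD(1)] _ complete] bbPT
    by metis
  then have "closed (range (P \<circ> (T \<circ> P)))"
    by (simp add: complete_imp_closed image_image o_def)
  then obtain R2 where R2: "R2 \<in> projections A" "range R2 = range (P \<circ> (T \<circ> P))"
    using closed_range_projection[OF A PTP] by metis
  define Q where "Q = (\<lambda>x. x - R1 x)"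
  define S where "S = (\<lambda>x. x - R2 x)"
  have Q: "Q \<in> projections A" and S: "S \<in> projections A"
    using projections_complement[OF A] R1 R2 by (auto simp: Q_def S_def)
  have ranQ: "range (\<lambda>x. x - Q x) = T ` range P"
    using R1(2) by (simp add: Q_def image_comp)
  have ranS: "y \<in> range S \<longleftrightarrow> R2 y = 0" for y
    unfolding S_def by (rule projection_range(2)[OF A R2(1)])
  have R2A: "R2 \<in> A" and R2adj: "\<And>x y. cinner (R2 x) y = cinner x (R2 y)"
    using R2 by (auto simp: projections_def adjoint_pair_def)
  note R2D = bounded_clinearD[OF vN(1)[OF R2A]]
  have PR2: "P (R2 x) = R2 x" for x
  proof -
    have "R2 x \<in> range (P \<circ> (T \<circ> P))"
      using R2(2) by blast
    then show ?thesis
      using idem by auto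
  qed
  have R2P: "R2 (P x) = R2 x" for x
  proof -
    have "cinner (R2 (P x) - R2 x) y = 0" for y
      using P by (simp add: cinner_diff_left R2adj projections_def adjoint_pair_def PR2)
    then show ?thesis
      using cinner_self_eq_0[of "R2 (P x) - R2 x"] by simp
  qed
  have R2T: "R2 (T x) = P (T x)" if x: "x \<in> range P" for x
  proof -
    have "P (T x) \<in> range R2"
      using x RP(1)[of x] R2(2) by (metis comp_apply rangeI)
    then show ?thesis
      using projection_range(1)[OF A R2(1)] R2P by metis
  qed
  obtain T' where hom: "homeomorphism (range P) (range (\<lambda>x. x - Q x)) T T'"
    using bounded_below_homeomorphism[OF TD(1) RP(3) bbT] ranQ by auto
  have "direct_decomposition (range (\<lambda>x. x - Q x)) (range S)"
    unfolding ranQ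
  proof (rule direct_decompositionI)
    show "y = 0" if yT: "y \<in> T ` range P" and yS: "y \<in> range S" for y
    proof -
      obtain x where x: "x \<in> range P" "y = T x"
        using yT by blast
      then have "P (T x) = 0"
        using yS ranS R2T by simp
      then have "c * norm x \<le> 0"
        using cPT[OF x(1)] by simp
      then show ?thesis
        using c x(2) by (simp add: mult_le_0_iff TD)
    qed
    show "0 \<in> range S"
      using ranS R2D(5) by blast
    show "0 \<in> T ` range P"
      using image_eqI[of 0 T 0 "range P"] TD(5) subspace_0[OF RP(3)] by simp
    show "\<exists>m\<in>T ` range P. \<exists>k\<in>range S. y = m + k" for y
    proof -
      \<comment> \<open>The component of \<open>y\<close> in \<open>T(Im P)\<close> is the vector there with the same image under \<open>R2\<close>.\<close>
      obtain x where x: "x \<in> range P" "R2 y = P (T x)"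
      proof -
        have "R2 y \<in> range (P \<circ> (T \<circ> P))"
          using R2(2) by blast
        then obtain w where "R2 y = P (T (P w))"
          by auto
        then show thesis
          by (intro that[of "P w"]) auto
      qed
      then have "R2 (y - T x) = 0"
        by (simp add: R2D R2T)
      then have "y - T x \<in> range S"
        using ranS by blast
      then show ?thesis
        using x(1) by (intro bexI[of _ "T x"] bexI[of _ "y - T x"]) auto
    qed
  qed
  moreover have "range (\<lambda>x. x - P x) \<subseteq> range S"
    using ranS R2P by (auto simp: R2D)
  moreover have "\<exists>T'. homeomorphism (range (\<lambda>x. x - (x - P x))) (range (\<lambda>x. x - Q x)) T T'"
    using hom by auto
  ultimately show ?thesis
    unfolding KPhi_def
    by (intro CollectI conjI TA fin bexI[OF _ P'] bexI[OF _ Q] bexI[OF _ S])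
qed

theorem corollary4p12:
  fixes A :: "('a::complex_hilbert \<Rightarrow> 'a) set" and F :: "'a \<Rightarrow> 'a"
  assumes "von_neumann_algebra A" and "properly_infinite A" and "F \<in> A"
  shows "sigma_eA A F =
    \<Inter> {sigma_a_compression P F | P. P \<in> projections A \<and> finite_projection A (\<lambda>x. x - P x)}"
proof -
  have TA: "(\<lambda>x. F x - l *\<^sub>C x) \<in> A" for l
    using von_neumann_algebra_closed(2,4)[OF assms(1)] assms(3) by blast
  have compression: "l \<notin> sigma_a_compression P F \<longleftrightarrow>
      bounded_below_on (\<lambda>x. P (F x - l *\<^sub>C x)) (range P)" if P: "P \<in> projections A" for l P
  proof -
    have "P \<in> A"
      using P by (simp add: projections_def)
    note PD = bounded_clinearD[OF von_neumann_algebra_closed(1)[OF assms(1) this]]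
    have "P (F x - l *\<^sub>C x) = P (F x) - l *\<^sub>C x" if "x \<in> range P" for x
      using projection_range(1)[OF assms(1) P] that by (simp add: PD)
    then show ?thesis
      by (simp add: sigma_a_compression_def bounded_below_on_def)
  qed
  have "l \<notin> sigma_eA A F \<longleftrightarrow>
      (\<exists>P\<in>projections A. finite_projection A (\<lambda>x. x - P x) \<and> l \<notin> sigma_a_compression P F)" for l
    using KPhi_imp_compression_bounded_below[OF assms(1), of "\<lambda>x. F x - l *\<^sub>C x"]
      compression_bounded_below_imp_KPhi[OF assms(1) TA] compression
    unfolding sigma_eA_def by blast
  then show ?thesis
    by blast
qed

end
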